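(* Let $\mathbb{X}$ be a normed space. If $f:[a,b]\to\mathbb{X}$ is a function of weakly bounded variation, then for each $x_0\in\mathbb{X}\setminus\{0\}$ there exist an extensible cone $\mathbb{X}_{x_0}^+$ in $\mathbb{X}$ and functions $f_{x_{0,1}},f_{x_{0,2}}:[a,b]\to\mathbb{X}$, increasing in $(\mathbb{X},\mathbb{X}_{x_0}^+)$, such that $f\sim_{x_0}(f_{x_{0,1}}-f_{x_{0,2}})$. In other words, given a function of weakly bounded variation $f:[a,b]\to\mathbb{X}$ (and $x_0\in\mathbb{X}\setminus\{0\}$), there exist functions of weakly bounded variation $f_{x_{0,1}},f_{x_{0,2}}:[a,b]\to\mathbb{X}$ such that $f\sim_{x_0}(f_{x_{0,1}}-f_{x_{0,2}})$.
   Context: Vector spaces are real, and $\mathbb{X}^*$ is the space of bounded linear functionals on $\mathbb{X}$. A cone in $\mathbb{X}$ is a non-empty subset of $\mathbb{X}$ closed under addition and under multiplication by non-negative reals. A cone $\mathbb{X}^+$ in $\mathbb{X}$ is called an extensible cone if there exist a cone $\mathbb{X}_+$ in $\mathbb{X}$ and $\alpha>0$ such that $B(x,\alpha\|x\|)\subseteq\mathbb{X}_+$ for any $x\in\mathbb{X}^+$, where $B(x,r)$ denotes the ball with centre $x$ and radius $r$. Induced functional and cone: for $x_0\in\mathbb{X}\setminus\{0\}$, the functional $y^*(\beta x_0)=\beta\|x_0\|^2$ on $\mathrm{span}\{x_0\}$ has norm $\|x_0\|$; let $x^*\in\mathbb{X}^*$ be a fixed norm-preserving Hahn–Banach extension of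 it (so $x^*(x_0)=\|x_0\|^2$ and $\|x^*\|=\|x_0\|$), called the bounded linear functional induced by $x_0$. The cone induced by $x_0$ is $\mathbb{X}_{x_0}^+=\{x\in\mathbb{X}:x^*(x)\ge\alpha\|x\|\}$ for some fixed $\alpha\in(0,\|x_0\|]$. For functions $f_1,f_2:[a,b]\to\mathbb{X}$, $f_1\sim_{x_0}f_2$ means $x^*(f_1(t))=x^*(f_2(t))$ for all $t\in[a,b]$. $[a,b]=\{t:a\le t\le b\}$, $a\le b$, is an order interval in a real ordered vector space $(\mathbb{Y},\mathbb{Y}^+)$ (for instance a closed interval of $\mathbb{R}$), where $\mathbb{Y}^+$ is a cone and $s\le t$ iff $t-s\in\mathbb{Y}^+$. A function $g:[a,b]\to\mathbb{R}$ is of bounded variation if the sums $\sum_{i=1}^n|g(t_i)-g(t_{i-1})|$ over all finite partitions $a=t_0\le t_1\le\dots\le t_n=b$ are bounded above. A function $f:[a,b]\to\mathbb{X}$ is of weakly bounded variation if $z^*\circ f:[a,b]\to\mathbb{R}$ is of bounded variation for all $z^*\in\mathbb{X}^*$. A function $g:[a,b]\to\mathbb{X}$ is increasing in $(\mathbb{X},\mathbb{X}_{x_0}^+)$ if $s\le t$ in $[a,b]$ implies $g(t)-g(s)\in\mathbb{X}_{x_0}^+$. *)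

theory Defs
  imports "HOL-Analysis.Analysis"
begin

text \<open>
  A cone in the sense used here, i.e. a non-empty set closed under addition and under
  multiplication by non-negative reals, is the library's \<^const>\<open>convex_cone\<close>.
\<close>

lemma convex_cone_closure_iff:
  "convex_cone S \<longleftrightarrow>
     S \<noteq> {} \<and> (\<forall>x\<in>S. \<forall>y\<in>S. x + y \<in> S) \<and> (\<forall>x\<in>S. \<forall>c\<ge>0. c *\<^sub>R x \<in> S)"
proof -
  have "convex S \<and> conic S \<longleftrightarrow> (\<forall>x\<in>S. \<forall>y\<in>S. x + y \<in> S) \<and> conic S"
    using convex_cone[of S] by (auto simp: cone_def conic_def)
  then show ?thesis by (auto simp: convex_cone_def conic_def)
qed

text \<open>
  Closed balls are used. With open balls one gets the same notion: a closed ball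
  of radius \<open>\<alpha> * norm x / 2\<close> lies in the open one of radius \<open>\<alpha> * norm x\<close> if \<open>x \<noteq> 0\<close>, and
  the only additional requirement at \<open>x = 0\<close> is that \<open>0\<close> lies in the larger cone, which is automatic.
\<close>

definition extensible_cone :: "'x::real_normed_vector set \<Rightarrow> bool" where
  "extensible_cone K \<longleftrightarrow>
     convex_cone K \<and>
     (\<exists>L \<alpha>. convex_cone L \<and> \<alpha> > 0 \<and> (\<forall>x\<in>K. cball x (\<alpha> * norm x) \<subseteq> L))"

text \<open>
  The norm on \<^typ>\<open>'x \<Rightarrow>\<^sub>L real\<close> is the operator norm, so this says that \<open>xs\<close> is a
  norm-preserving extension of the functional \<open>\<beta> *\<^sub>R x0 \<mapsto> \<beta> * (norm x0)\<^sup>2\<close>, whose norm is \<open>norm x0\<close>.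
\<close>

definition induced_functional :: "'x::real_normed_vector \<Rightarrow> ('x \<Rightarrow>\<^sub>L real) \<Rightarrow> bool" where
  "induced_functional x0 xs \<longleftrightarrow>
     (\<forall>\<beta>. blinfun_apply xs (\<beta> *\<^sub>R x0) = \<beta> * (norm x0)\<^sup>2) \<and> norm xs = norm x0"

definition induced_cone :: "('x::real_normed_vector \<Rightarrow>\<^sub>L real) \<Rightarrow> real \<Rightarrow> 'x set" where
  "induced_cone xs \<alpha> = {x. blinfun_apply xs x \<ge> \<alpha> * norm x}"

text \<open>
  The order on the domain space is given by an explicit cone \<open>P\<close>. It is not required to be pointed, so the
  relation is in general only a preorder. Functions on an order interval are
  total functions, of which only the values on the interval are constrained.
\<close>

definition cone_le :: "'y::real_vector set \<Rightarrow> 'y \<Rightarrow> 'y \<Rightarrow> bool" where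
  "cone_le P s t \<longleftrightarrow> t - s \<in> P"

definition order_interval :: "'y::real_vector set \<Rightarrow> 'y \<Rightarrow> 'y \<Rightarrow> 'y set" where
  "order_interval P a b = {t. cone_le P a t \<and> cone_le P t b}"

definition order_partition :: "'y::real_vector set \<Rightarrow> 'y \<Rightarrow> 'y \<Rightarrow> nat \<Rightarrow> (nat \<Rightarrow> 'y) \<Rightarrow> bool" where
  "order_partition P a b n t \<longleftrightarrow>
     t 0 = a \<and> t n = b \<and> (\<forall>i\<in>{1..n}. cone_le P (t (i - 1)) (t i))"

definition bounded_variation ::
    "'y::real_vector set \<Rightarrow> 'y \<Rightarrow> 'y \<Rightarrow> ('y \<Rightarrow> real) \<Rightarrow> bool" where
  "bounded_variation P a b g \<longleftrightarrow>
     (\<exists>M. \<forall>n t. order_partition P a b n t \<longrightarrow> (\<Sum>i=1..n. \<bar>g (t i) - g (t (i - 1))\<bar>) \<le> M)"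

definition weakly_bounded_variation ::
    "'y::real_vector set \<Rightarrow> 'y \<Rightarrow> 'y \<Rightarrow> ('y \<Rightarrow> 'x::real_normed_vector) \<Rightarrow> bool" where
  "weakly_bounded_variation P a b f \<longleftrightarrow>
     (\<forall>zs :: 'x \<Rightarrow>\<^sub>L real. bounded_variation P a b (\<lambda>t. blinfun_apply zs (f t)))"

definition increasing_in ::
    "'x::real_normed_vector set \<Rightarrow> 'y::real_vector set \<Rightarrow> 'y \<Rightarrow> 'y \<Rightarrow> ('y \<Rightarrow> 'x) \<Rightarrow> bool" where
  "increasing_in K P a b g \<longleftrightarrow>
     (\<forall>s\<in>order_interval P a b. \<forall>t\<in>order_interval P a b. cone_le P s t \<longrightarrow> g t - g s \<in> K)"

definition sim_on ::
    "('x::real_normed_vector \<Rightarrow>\<^sub>L real) \<Rightarrow> 'y::real_vector set \<Rightarrow> 'y \<Rightarrow> 'y \<Rightarrow> ('y \<Rightarrow> 'x) \<Rightarrow> ('y \<Rightarrow> 'x) \<Rightarrow> bool" where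
  "sim_on xs P a b f g \<longleftrightarrow>
     (\<forall>t\<in>order_interval P a b. blinfun_apply xs (f t) = blinfun_apply xs (g t))"

text \<open>
  The Hahn-Banach theorem in the form needed here, so that quantifying over all functionals
  induced by \<open>x0\<close> is never vacuous. A pointwise minimal sublinear functional is linear.
\<close>

definition sublinear :: "('a::real_vector \<Rightarrow> real) \<Rightarrow> bool" where
  "sublinear q \<longleftrightarrow> (\<forall>x y. q (x + y) \<le> q x + q y) \<and> (\<forall>x. \<forall>c\<ge>0. q (c *\<^sub>R x) = c * q x)"

lemma sublinearD:
  assumes "sublinear q"
  shows "q (x + y) \<le> q x + q y" "c \<ge> 0 \<Longrightarrow> q (c *\<^sub>R x) = c * q x" "q 0 = 0" "- q (- x) \<le> q x"
proof -
  show 1: "q (x + y) \<le> q x + q y" for x y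
    using assms by (auto simp: sublinear_def)
  show 2: "c \<ge> 0 \<Longrightarrow> q (c *\<^sub>R x) = c * q x" for c x
    using assms by (auto simp: sublinear_def)
  show 3: "q 0 = 0" using 2[of 0 0] by simp
  show "- q (- x) \<le> q x" using 1[of x "-x"] 3 by simp
qed

lemma sublinearI:
  assumes "\<And>x y. q (x + y) \<le> q x + q y" "\<And>x c. c > 0 \<Longrightarrow> q (c *\<^sub>R x) \<le> c * q x" "q 0 = 0"
  shows "sublinear q"
  unfolding sublinear_def
proof (intro conjI allI impI)
  fix x and c :: real assume "c \<ge> 0"
  show "q (c *\<^sub>R x) = c * q x"
  proof (cases "c = 0")
    case False
    with \<open>c \<ge> 0\<close> have c: "c > 0" by simp
    have "q (inverse c *\<^sub>R (c *\<^sub>R x)) \<le> inverse c * q (c *\<^sub>R x)"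
      by (rule assms(2)) (use c in simp)
    then have "c * q x \<le> q (c *\<^sub>R x)" using c by (simp add: field_simps)
    with assms(2)[OF c, of x] show ?thesis by simp
  qed (simp add: assms(3))
qed (rule assms(1))

lemma sublinear_reduce:
  assumes q: "sublinear q"
  obtains r where "sublinear r" "\<And>x. r x \<le> q x" "\<And>x. r x \<le> q (x + y) - q y"
proof -
  define A where "A x = (\<lambda>t. q (x + t *\<^sub>R y) - t * q y) ` {0..}" for x
  define r where "r x = Inf (A x)" for x
  have lb: "- q (- x) \<le> z" if "z \<in> A x" for x z
  proof -
    from that obtain t where t: "t \<ge> 0" "z = q (x + t *\<^sub>R y) - t * q y" by (auto simp: A_def)
    have "q ((x + t *\<^sub>R y) + - x) \<le> q (x + t *\<^sub>R y) + q (- x)" by (rule sublinearD[OF q])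
    then show ?thesis using sublinearD(2)[OF q t(1), of y] t by (simp add: algebra_simps)
  qed
  have bdd: "bdd_below (A x)" for x using lb by (meson bdd_belowI)
  have le: "r x \<le> q (x + t *\<^sub>R y) - t * q y" if "t \<ge> 0" for x t
    unfolding r_def by (rule cInf_lower[OF _ bdd]) (use that in \<open>auto simp: A_def\<close>)
  have ge: "z \<le> r x" if "\<And>t. t \<ge> 0 \<Longrightarrow> z \<le> q (x + t *\<^sub>R y) - t * q y" for x z
    unfolding r_def by (rule cInf_greatest) (use that in \<open>auto simp: A_def\<close>)
  have "sublinear r"
  proof (rule sublinearI)
    fix x z
    have *: "r (x + z) \<le> (q (x + t *\<^sub>R y) - t * q y) + (q (z + u *\<^sub>R y) - u * q y)"
      if "t \<ge> 0" "u \<ge> 0" for t u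
      using le[of "t + u" "x + z"] sublinearD(1)[OF q, of "x + t *\<^sub>R y" "z + u *\<^sub>R y"] that
      by (simp add: algebra_simps)
    have "r (x + z) - (q (x + t *\<^sub>R y) - t * q y) \<le> r z" if "t \<ge> 0" for t
      by (rule ge) (use *[OF that] in \<open>simp add: algebra_simps\<close>)
    then have "r (x + z) - r z \<le> r x"
      by (intro ge) (simp add: algebra_simps)
    then show "r (x + z) \<le> r x + r z" by simp
  next
    fix x and c :: real assume c: "c > 0"
    have "r (c *\<^sub>R x) / c \<le> r x"
    proof (rule ge)
      fix t :: real assume t: "t \<ge> 0"
      have "r (c *\<^sub>R x) \<le> q (c *\<^sub>R x + (c * t) *\<^sub>R y) - (c * t) * q y"
        by (rule le) (use c t in simp)
      also have "c *\<^sub>R x + (c * t) *\<^sub>R y = c *\<^sub>R (x + t *\<^sub>R y)" by (simp add: algebra_simps)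
      also have "q \<dots> = c * q (x + t *\<^sub>R y)" using c by (intro sublinearD(2)[OF q]) simp
      finally show "r (c *\<^sub>R x) / c \<le> q (x + t *\<^sub>R y) - t * q y"
        using c by (simp add: field_simps)
    qed
    then show "r (c *\<^sub>R x) \<le> c * r x" using c by (simp add: field_simps)
  next
    have "r 0 \<le> 0" using le[of 0 0] sublinearD(3)[OF q] by simp
    moreover have "0 \<le> r 0" by (rule ge) (simp add: sublinearD(2)[OF q])
    ultimately show "r 0 = 0" by simp
  qed
  moreover have "r x \<le> q x" for x using le[of 0 x] by simp
  moreover have "r x \<le> q (x + y) - q y" for x using le[of 1 x] by simp
  ultimately show ?thesis using that by blast
qed

lemma sublinear_minorant_linear:
  fixes p :: "'a::real_vector \<Rightarrow> real"
  assumes p: "sublinear p"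
  obtains g where "linear g" "\<And>x. g x \<le> p x"
proof -
  define S where "S = {q. sublinear q \<and> q \<le> p}"
  let ?R = "\<lambda>f g :: 'a \<Rightarrow> real. g \<le> f"
  have "\<exists>m\<in>S. \<forall>q\<in>S. ?R m q \<longrightarrow> q = m"
  proof (rule predicate_Zorn)
    show "partial_order_on S (relation_of ?R S)"
      by (rule partial_order_on_relation_ofI) auto
  next
    fix C assume C: "C \<in> Chains (relation_of ?R S)"
    then have CS: "C \<subseteq> S" and ch: "\<And>q r. q \<in> C \<Longrightarrow> r \<in> C \<Longrightarrow> q \<le> r \<or> r \<le> q"
      by (auto simp: Chains_def relation_of_def)
    show "\<exists>u\<in>S. \<forall>q\<in>C. u \<le> q"
    proof (cases "C = {}")
      case True
      then show ?thesis using p by (auto simp: S_def)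
    next
      case False
      define u where "u x = Inf ((\<lambda>q. q x) ` C)" for x
      have sl: "sublinear q" and qp: "q x \<le> p x" if "q \<in> C" for q x
        using that CS by (auto simp: S_def le_fun_def)
      have bdd: "bdd_below ((\<lambda>q. q x) ` C)" for x
      proof (rule bdd_belowI2)
        fix q assume "q \<in> C"
        then show "- p (- x) \<le> q x" using sublinearD(4)[OF sl, of q x] qp[of q "-x"] by simp
      qed
      have le: "u x \<le> q x" if "q \<in> C" for q x
        unfolding u_def by (rule cInf_lower[OF _ bdd]) (use that in auto)
      have ge: "z \<le> u x" if "\<And>q. q \<in> C \<Longrightarrow> z \<le> q x" for x z
        unfolding u_def by (rule cInf_greatest) (use that False in auto)
      have "sublinear u"
      proof (rule sublinearI)
        fix x y
        have *: "u (x + y) \<le> q x + r y" if qr: "q \<in> C" "r \<in> C" for q r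
          using ch[OF qr]
        proof
          assume "q \<le> r"
          then have "q y \<le> r y" by (simp add: le_fun_def)
          then show ?thesis using le[OF qr(1), of "x + y"] sublinearD(1)[OF sl[OF qr(1)], of x y] by simp
        next
          assume "r \<le> q"
          then have "r x \<le> q x" by (simp add: le_fun_def)
          then show ?thesis using le[OF qr(2), of "x + y"] sublinearD(1)[OF sl[OF qr(2)], of x y] by simp
        qed
        have "u (x + y) - q x \<le> u y" if "q \<in> C" for q
          by (rule ge) (use *[OF that] in \<open>simp add: algebra_simps\<close>)
        then have "u (x + y) - u y \<le> u x" by (intro ge) (simp add: algebra_simps)
        then show "u (x + y) \<le> u x + u y" by simp
      next
        fix x and c :: real assume c: "c > 0"
        have "u (c *\<^sub>R x) / c \<le> u x"
        proof (rule ge)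
          fix q assume q: "q \<in> C"
          have "u (c *\<^sub>R x) \<le> c * q x"
            using le[OF q, of "c *\<^sub>R x"] sublinearD(2)[OF sl[OF q], of c x] c by simp
          then show "u (c *\<^sub>R x) / c \<le> q x" using c by (simp add: field_simps)
        qed
        then show "u (c *\<^sub>R x) \<le> c * u x" using c by (simp add: field_simps)
      next
        obtain q where q: "q \<in> C" using False by blast
        have "u 0 \<le> 0" using le[OF q, of 0] sublinearD(3)[OF sl[OF q]] by simp
        moreover have "0 \<le> u 0" by (rule ge) (simp add: sublinearD(3)[OF sl])
        ultimately show "u 0 = 0" by simp
      qed
      moreover have "u \<le> p"
      proof -
        obtain q where "q \<in> C" using False by blast
        then show ?thesis using le qp by (metis le_funI order_trans)
      qed
      ultimately show ?thesis using le by (auto simp: S_def le_fun_def intro!: bexI[of _ u])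
    qed
  qed
  then obtain g where g: "sublinear g" "g \<le> p" and min: "\<And>q. sublinear q \<Longrightarrow> q \<le> g \<Longrightarrow> q = g"
    unfolding S_def using order_trans by blast
  have add: "g (x + y) = g x + g y" for x y
  proof -
    obtain r where r: "sublinear r" "\<And>x. r x \<le> g x" "\<And>x. r x \<le> g (x + y) - g y"
      using sublinear_reduce[OF g(1)] by metis
    have "r = g" using r by (intro min) (auto simp: le_fun_def)
    then show ?thesis using r(3)[of x] sublinearD(1)[OF g(1), of x y] by simp
  qed
  have neg: "g (- x) = - g x" for x
    using add[of x "-x"] sublinearD(3)[OF g(1)] by simp
  have "linear g"
  proof (rule linearI)
    fix c x
    show "g (c *\<^sub>R x) = c *\<^sub>R g x"
    proof (cases "c \<ge> 0")
      case False
      then have "g ((- c) *\<^sub>R x) = (- c) * g x" by (intro sublinearD(2)[OF g(1)]) simp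
      then show ?thesis using neg[of "c *\<^sub>R x"] by simp
    qed (simp add: sublinearD(2)[OF g(1)])
  qed (rule add)
  then show ?thesis using that g(2) by (auto simp: le_fun_def)
qed

lemma induced_functional_exists:
  fixes x0 :: "'x::real_normed_vector"
  assumes "x0 \<noteq> 0"
  shows "\<exists>xs. induced_functional x0 xs"
proof -
  let ?p = "\<lambda>x. norm x0 * norm x"
  have "sublinear ?p"
    unfolding sublinear_def by (auto simp: norm_triangle_ineq mult_left_mono simp flip: distrib_left)
  then obtain r where r: "sublinear r" "\<And>x. r x \<le> ?p x" "\<And>x. r x \<le> ?p (x + x0) - ?p x0"
    using sublinear_reduce by metis
  obtain g where g: "linear g" "\<And>x. g x \<le> r x"
    using sublinear_minorant_linear[OF r(1)] by metis
  have gp: "g x \<le> norm x0 * norm x" for x using g(2) r(2) order_trans by blast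
  have neg: "g (- x) = - g x" for x using g(1) by (rule linear_neg)
  have abs: "\<bar>g x\<bar> \<le> norm x0 * norm x" for x
    using gp[of x] gp[of "-x"] neg[of x] by simp
  have "g (- x0) \<le> - (norm x0 * norm x0)" using g(2)[of "-x0"] r(3)[of "-x0"] by simp
  then have gx0: "g x0 = (norm x0)\<^sup>2" using gp[of x0] neg[of x0] by (simp add: power2_eq_square)
  have bl: "bounded_linear g"
    by (rule bounded_linear_intro[where K = "norm x0"])
      (use abs g(1) in \<open>auto simp: linear_add linear_scale mult.commute\<close>)
  define xs where "xs = Blinfun g"
  have ap: "blinfun_apply xs x = g x" for x
    unfolding xs_def using bl by (simp add: bounded_linear_Blinfun_apply)
  have "norm xs \<le> norm x0" by (rule norm_blinfun_bound) (use abs ap in auto)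
  moreover have "norm x0 \<le> norm xs"
    using norm_blinfun[of xs x0] assms by (simp add: ap gx0 power2_eq_square)
  ultimately show ?thesis
    unfolding induced_functional_def using ap gx0 g(1) by (intro exI[of _ xs]) (auto simp: linear_scale)
qed

end

theory Submission
  imports Defs
begin

text \<open>
  The relation \<open>f \<sim> h\<close> only sees the scalar function \<open>g = xs \<circ> f\<close>, which has bounded variation
  because \<open>f\<close> has weakly bounded variation. So the statement is the scalar Jordan decomposition,
  carried out on an order interval and then placed on the ray through \<open>x0\<close>. Let \<open>V t\<close> be the total
  variation of \<open>g\<close> from \<open>a\<close> to \<open>t\<close>. Appending a point to a partition gives
  \<open>V s + \<bar>g t - g s\<bar> \<le> V t\<close> for \<open>s \<le> t\<close> (\<open>total_variation_add_le\<close>); hence \<open>V\<close> and \<open>V - g\<close> are both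
  increasing.

  Multiplying \<open>V\<close> and \<open>V - g\<close> by \<open>x0 / (norm x0)\<^sup>2\<close>, on which \<open>xs\<close> takes the value \<open>1\<close>, gives vector
  valued functions whose increments are non-negative multiples of \<open>x0\<close>. Since
  \<open>xs x0 = norm x0 * norm x0\<close>, these lie in the induced cone even for the largest admissible
  parameter \<open>\<alpha> = norm x0\<close> (\<open>ray_in_induced_cone\<close>). Every induced cone is extensible, because
  \<open>xs\<close> remains non-negative on balls of radius proportional to \<open>norm x\<close> (\<open>extensible_induced_cone\<close>).

  Finally, weakly bounded variation of the two functions is a consequence of monotonicity alone: on
  the induced cone the norm, and with it every bounded functional, is dominated by a multiple of
  \<open>xs\<close>, whose increments telescope (\<open>increasing_imp_weakly_bounded_variation\<close>).
\<close>

section \<open>Order intervals and partitions\<close>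

lemma cone_le_refl: "convex_cone P \<Longrightarrow> cone_le P s s"
  by (simp add: cone_le_def convex_cone_contains_0)

lemma cone_le_trans:
  assumes "convex_cone P" "cone_le P s t" "cone_le P t u"
  shows "cone_le P s u"
proof -
  have "(u - t) + (t - s) \<in> P"
    using assms unfolding cone_le_def convex_cone_closure_iff by blast
  then show ?thesis by (simp add: cone_le_def)
qed

lemma order_partition_cone_le:
  assumes P: "convex_cone P" and part: "order_partition P a b n t" and "i \<le> j" "j \<le> n"
  shows "cone_le P (t i) (t j)"
  using \<open>i \<le> j\<close> \<open>j \<le> n\<close>
proof (induction j rule: dec_induct)
  case base
  then show ?case by (simp add: cone_le_refl[OF P])
next
  case (step j)
  have "cone_le P (t j) (t (Suc j))"
    using part step.prems by (force simp: order_partition_def)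
  with step show ?case by (meson Suc_leD cone_le_trans[OF P])
qed

lemma order_partition_in_order_interval:
  assumes "convex_cone P" "order_partition P a b n t" "i \<le> n"
  shows "t i \<in> order_interval P a b"
  using order_partition_cone_le[OF assms(1,2), of 0 i] order_partition_cone_le[OF assms(1,2), of i n] assms
  by (simp add: order_interval_def order_partition_def)

section \<open>Total variation on an order interval\<close>

definition variation_sums :: "'y::real_vector set \<Rightarrow> 'y \<Rightarrow> ('y \<Rightarrow> real) \<Rightarrow> 'y \<Rightarrow> real set" where
  "variation_sums P a g s =
     {\<Sum>i=1..n. \<bar>g (t i) - g (t (i - 1))\<bar> | n t. order_partition P a s n t}"

definition total_variation :: "'y::real_vector set \<Rightarrow> 'y \<Rightarrow> ('y \<Rightarrow> real) \<Rightarrow> 'y \<Rightarrow> real" where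
  "total_variation P a g s = Sup (variation_sums P a g s)"

lemma bounded_variation_iff: "bounded_variation P a b g \<longleftrightarrow> bdd_above (variation_sums P a g b)"
  unfolding bounded_variation_def variation_sums_def bdd_above_def by blast

lemma variation_sums_append:
  assumes v: "v \<in> variation_sums P a g s" and st: "cone_le P s t"
  shows "v + \<bar>g t - g s\<bar> \<in> variation_sums P a g t"
proof -
  obtain n u where part: "order_partition P a s n u"
    and v: "v = (\<Sum>i=1..n. \<bar>g (u i) - g (u (i - 1))\<bar>)"
    using v by (auto simp: variation_sums_def)
  define w where "w = u(Suc n := t)"
  have "order_partition P a t (Suc n) w"
    using part st by (auto simp: order_partition_def w_def le_Suc_eq)
  moreover have "(\<Sum>i=1..Suc n. \<bar>g (w i) - g (w (i - 1))\<bar>) = v + \<bar>g t - g s\<bar>"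
  proof -
    have "(\<Sum>i=1..n. \<bar>g (w i) - g (w (i - 1))\<bar>) = v"
      unfolding v by (rule sum.cong) (auto simp: w_def)
    then show ?thesis using part by (simp add: w_def order_partition_def)
  qed
  ultimately show ?thesis unfolding variation_sums_def by force
qed

lemma variation_sums_nonempty:
  assumes "cone_le P a s"
  shows "variation_sums P a g s \<noteq> {}"
proof -
  \<comment> \<open>The partition with the single point \<open>a\<close>, to which \<open>s\<close> is then appended.\<close>
  have "order_partition P a a 0 (\<lambda>_. a)" by (simp add: order_partition_def)
  then have "0 \<in> variation_sums P a g a" by (force simp: variation_sums_def)
  then show ?thesis using variation_sums_append[OF _ assms] by blast
qed

lemma bdd_above_variation_sums:
  assumes "bdd_above (variation_sums P a g b)" and "cone_le P s b"
  shows "bdd_above (variation_sums P a g s)"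
proof -
  obtain M where M: "\<And>v. v \<in> variation_sums P a g b \<Longrightarrow> v \<le> M"
    using assms(1) by (auto simp: bdd_above_def)
  show ?thesis
    by (rule bdd_aboveI[of _ M]) (use variation_sums_append[OF _ assms(2)] M in force)
qed

text \<open>
  A partition from \<open>a\<close> to \<open>t\<close> cannot in general be refined by \<open>s\<close>, since its points may be
  incomparable with \<open>s\<close>; so the variation is only superadditive, not additive as on the real line.
  Superadditivity already gives the inequality: the partitions through \<open>s\<close> provide the lower bound.
\<close>

lemma total_variation_add_le:
  assumes "bounded_variation P a b g" "cone_le P a s" "cone_le P s t" "cone_le P t b"
  shows "total_variation P a g s + \<bar>g t - g s\<bar> \<le> total_variation P a g t"
proof -
  have bdd: "bdd_above (variation_sums P a g t)"
    by (rule bdd_above_variation_sums[OF assms(1)[unfolded bounded_variation_iff] assms(4)])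
  have "v \<le> total_variation P a g t - \<bar>g t - g s\<bar>" if "v \<in> variation_sums P a g s" for v
    using cSup_upper[OF variation_sums_append[OF that assms(3)] bdd]
    by (simp add: total_variation_def)
  then have "total_variation P a g s \<le> total_variation P a g t - \<bar>g t - g s\<bar>"
    unfolding total_variation_def[of P a g s]
    by (rule cSup_least[OF variation_sums_nonempty[OF assms(2)]])
  then show ?thesis by simp
qed

section \<open>Induced cones\<close>

lemma convex_cone_induced_cone:
  assumes "\<alpha> \<ge> 0"
  shows "convex_cone (induced_cone xs \<alpha>)"
  unfolding convex_cone_closure_iff
proof (intro conjI ballI allI impI)
  have "0 \<in> induced_cone xs \<alpha>" by (simp add: induced_cone_def blinfun.zero_right)
  then show "induced_cone xs \<alpha> \<noteq> {}" by blast
next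
  fix x y assume "x \<in> induced_cone xs \<alpha>" "y \<in> induced_cone xs \<alpha>"
  moreover have "\<alpha> * norm (x + y) \<le> \<alpha> * norm x + \<alpha> * norm y"
    using mult_left_mono[OF norm_triangle_ineq assms, of x y] by (simp add: algebra_simps)
  ultimately show "x + y \<in> induced_cone xs \<alpha>"
    by (simp add: induced_cone_def blinfun.add_right)
next
  fix x and c :: real assume "x \<in> induced_cone xs \<alpha>" "0 \<le> c"
  then show "c *\<^sub>R x \<in> induced_cone xs \<alpha>"
    using mult_left_mono[of "\<alpha> * norm x" "blinfun_apply xs x" c]
    by (simp add: induced_cone_def blinfun.scaleR_right algebra_simps)
qed

text \<open>
  The half-space \<open>xs \<ge> 0\<close> serves as the larger cone: moving a point \<open>x\<close> of the induced cone by at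
  most \<open>\<alpha> / norm xs * norm x\<close> changes the value of \<open>xs\<close> by at most \<open>\<alpha> * norm x\<close>.
\<close>

lemma extensible_induced_cone:
  assumes "\<alpha> > 0" "xs \<noteq> 0"
  shows "extensible_cone (induced_cone xs \<alpha>)"
proof -
  have "cball x (\<alpha> / norm xs * norm x) \<subseteq> induced_cone xs 0" if "x \<in> induced_cone xs \<alpha>" for x
  proof
    fix y assume "y \<in> cball x (\<alpha> / norm xs * norm x)"
    then have "norm xs * norm (x - y) \<le> \<alpha> * norm x"
      using assms by (simp add: dist_norm field_simps)
    moreover have "blinfun_apply xs x - blinfun_apply xs y \<le> norm xs * norm (x - y)"
      using norm_blinfun[of xs "x - y"] by (simp add: blinfun.diff_right)
    ultimately show "y \<in> induced_cone xs 0"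
      using that by (simp add: induced_cone_def)
  qed
  moreover have "\<alpha> / norm xs > 0" using assms by simp
  moreover have "convex_cone (induced_cone xs \<alpha>)" "convex_cone (induced_cone xs 0)"
    using assms(1) by (simp_all add: convex_cone_induced_cone)
  ultimately show ?thesis
    unfolding extensible_cone_def by blast
qed

lemma ray_in_induced_cone:
  assumes "induced_functional x0 xs" "\<alpha> \<le> norm x0" "c \<ge> 0"
  shows "c *\<^sub>R x0 \<in> induced_cone xs \<alpha>"
proof -
  have "\<alpha> * norm (c *\<^sub>R x0) \<le> norm x0 * norm (c *\<^sub>R x0)"
    using assms(2) by (rule mult_right_mono) simp
  also have "\<dots> = blinfun_apply xs (c *\<^sub>R x0)"
    using assms by (simp add: induced_functional_def power2_eq_square)
  finally show ?thesis by (simp add: induced_cone_def)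
qed

text \<open>
  On the cone, \<open>\<bar>zs x\<bar> \<le> norm zs * norm x \<le> norm zs / \<alpha> * xs x\<close>, so the variation sums of
  \<open>zs \<circ> g\<close> are bounded by a telescoping sum of increments of \<open>xs \<circ> g\<close>.
\<close>

lemma increasing_imp_weakly_bounded_variation:
  assumes P: "convex_cone P" and "\<alpha> > 0" and inc: "increasing_in (induced_cone xs \<alpha>) P a b g"
  shows "weakly_bounded_variation P a b g"
  unfolding weakly_bounded_variation_def bounded_variation_def
proof (intro allI exI impI)
  fix zs n t assume part: "order_partition P a b n t"
  let ?h = "\<lambda>t. blinfun_apply xs (g t)"
  have "\<bar>blinfun_apply zs (g (t i)) - blinfun_apply zs (g (t (i - 1)))\<bar>
        \<le> norm zs / \<alpha> * (?h (t i) - ?h (t (i - 1)))" if i: "i \<in> {1..n}" for i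
  proof -
    let ?x = "g (t i) - g (t (i - 1))"
    have "t i \<in> order_interval P a b" "t (i - 1) \<in> order_interval P a b"
      using i by (auto intro: order_partition_in_order_interval[OF P part])
    moreover have "cone_le P (t (i - 1)) (t i)"
      using part i by (simp add: order_partition_def)
    ultimately have "?x \<in> induced_cone xs \<alpha>"
      using inc by (simp add: increasing_in_def)
    then have "norm ?x \<le> blinfun_apply xs ?x / \<alpha>"
      using \<open>\<alpha> > 0\<close> by (simp add: induced_cone_def field_simps)
    then have "norm zs * norm ?x \<le> norm zs / \<alpha> * blinfun_apply xs ?x"
      using mult_left_mono[of "norm ?x" "blinfun_apply xs ?x / \<alpha>" "norm zs"] by simp
    then show ?thesis
      using norm_blinfun[of zs ?x] by (simp add: blinfun.diff_right)
  qed
  then have "(\<Sum>i=1..n. \<bar>blinfun_apply zs (g (t i)) - blinfun_apply zs (g (t (i - 1)))\<bar>)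
        \<le> (\<Sum>i=1..n. norm zs / \<alpha> * (?h (t i) - ?h (t (i - 1))))"
    by (rule sum_mono)
  also have "\<dots> = norm zs / \<alpha> * (?h (t n) - ?h (t 0))"
    using sum_telescope''[of 0 n "\<lambda>i. ?h (t i)"] by (simp flip: sum_distrib_left sum_divide_distrib)
  also have "\<dots> = norm zs / \<alpha> * (?h b - ?h a)"
    using part by (simp add: order_partition_def)
  finally show "(\<Sum>i=1..n. \<bar>blinfun_apply zs (g (t i)) - blinfun_apply zs (g (t (i - 1)))\<bar>)
        \<le> norm zs / \<alpha> * (?h b - ?h a)" .
qed

section \<open>Jordan decomposition along the inducing vector\<close>

lemma increasing_along_ray:
  assumes "induced_functional x0 xs" "\<alpha> \<le> norm x0" "c \<ge> 0"
    and mono: "\<And>s t. cone_le P a s \<Longrightarrow> cone_le P s t \<Longrightarrow> cone_le P t b \<Longrightarrow> h s \<le> h t"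
  shows "increasing_in (induced_cone xs \<alpha>) P a b (\<lambda>t. (c * h t) *\<^sub>R x0)"
  unfolding increasing_in_def
proof (intro ballI impI)
  fix s t assume "s \<in> order_interval P a b" "t \<in> order_interval P a b" "cone_le P s t"
  then have "h s \<le> h t" by (intro mono) (simp_all add: order_interval_def)
  then have "c * (h t - h s) \<ge> 0" using \<open>c \<ge> 0\<close> by simp
  then have "(c * (h t - h s)) *\<^sub>R x0 \<in> induced_cone xs \<alpha>"
    by (rule ray_in_induced_cone[OF assms(1,2)])
  then show "(c * h t) *\<^sub>R x0 - (c * h s) *\<^sub>R x0 \<in> induced_cone xs \<alpha>"
    by (simp add: algebra_simps)
qed

theorem theorem4p6:
  fixes P :: "'y::real_vector set" and a b :: 'y
    and f :: "'y \<Rightarrow> 'x::real_normed_vector"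
    and x0 :: 'x and xs :: "'x \<Rightarrow>\<^sub>L real"
  assumes "convex_cone P"
    and "cone_le P a b"
    and "weakly_bounded_variation P a b f"
    and "x0 \<noteq> 0"
    and "induced_functional x0 xs"
  shows "\<exists>K f1 f2.
           (\<exists>\<alpha>. 0 < \<alpha> \<and> \<alpha> \<le> norm x0 \<and> K = induced_cone xs \<alpha>) \<and>
           extensible_cone K \<and>
           increasing_in K P a b f1 \<and> increasing_in K P a b f2 \<and>
           weakly_bounded_variation P a b f1 \<and> weakly_bounded_variation P a b f2 \<and>
           sim_on xs P a b f (\<lambda>t. f1 t - f2 t)"
proof -
  define g where "g t = blinfun_apply xs (f t)" for t
  define V where "V = total_variation P a g"
  \<comment> \<open>The factor for which \<open>xs (c *\<^sub>R x0) = 1\<close>.\<close>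
  define c where "c = 1 / (norm x0)\<^sup>2"
  define K where "K = induced_cone xs (norm x0)"
  define f1 where "f1 t = (c * V t) *\<^sub>R x0" for t
  define f2 where "f2 t = (c * (V t - g t)) *\<^sub>R x0" for t
  have pos: "norm x0 > 0" and c: "c \<ge> 0" using assms(4) by (auto simp: c_def)
  have bv: "bounded_variation P a b g"
    using assms(3) by (simp add: weakly_bounded_variation_def g_def[abs_def])
  have V: "V s + \<bar>g t - g s\<bar> \<le> V t" if "cone_le P a s" "cone_le P s t" "cone_le P t b" for s t
    unfolding V_def using bv that by (rule total_variation_add_le)
  have V_mono: "V s \<le> V t" and V_diff_mono: "V s - g s \<le> V t - g t"
    if "cone_le P a s" "cone_le P s t" "cone_le P t b" for s t
    using V[OF that] by linarith+
  have inc1: "increasing_in K P a b f1"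
    unfolding K_def f1_def
    by (rule increasing_along_ray[OF assms(5) order_refl c V_mono])
  have inc2: "increasing_in K P a b f2"
    unfolding K_def f2_def
    by (rule increasing_along_ray[OF assms(5) order_refl c V_diff_mono])
  have wbv: "weakly_bounded_variation P a b f1" "weakly_bounded_variation P a b f2"
    using inc1 inc2 increasing_imp_weakly_bounded_variation[OF assms(1) pos] by (auto simp: K_def)
  have ext: "extensible_cone K"
    unfolding K_def using pos assms(5)
    by (intro extensible_induced_cone) (auto simp: induced_functional_def)
  have "f1 t - f2 t = (c * g t) *\<^sub>R x0" for t
    by (simp add: f1_def f2_def algebra_simps)
  then have "sim_on xs P a b f (\<lambda>t. f1 t - f2 t)"
    using assms(4,5) by (simp add: sim_on_def induced_functional_def c_def g_def)
  then show ?thesis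
    using inc1 inc2 wbv ext pos K_def by blast
qed

end
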